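(* (Completeness) Every formula that is true at every world of every $\kappa$-model is derivable in $\mathsf{Syn}^-$.
   Context: Fix a finite set $\mathsf{Ag}$ of agents; an agent pattern is a set $G\subseteq\mathcal{P}(\mathsf{Ag})\setminus\{\emptyset\}$. Formulas: $\varphi::= p\mid\neg\varphi\mid\varphi\wedge\varphi\mid [G]\varphi$ ($p$ in a countable set $\mathsf{Prop}$, $G$ an agent pattern); $\bot:=p\wedge\neg p$ for fixed $p$; $\mathsf{alive}(G):=\neg[G]\bot$. $\mathsf{Syn}^-$ has axioms: all propositional tautologies; (K) $[G](\varphi\to\psi)\to([G]\varphi\to[G]\psi)$; (B) $\varphi\to[G]\neg[G]\neg\varphi$; (4) $[G]\varphi\to[G][G]\varphi$; (T) $\mathsf{alive}(G)\to([G]\varphi\to\varphi)$; (NE) $\bigvee_{G}\mathsf{alive}(G)$ over all agent patterns; (Mono) $[G]\varphi\to[H]\varphi$ if $G\subseteq H$; (Equiv) $[G\cup\{B\}]\varphi\to[G]\varphi$ if some $A\in G$ has $B\subseteq A$ ($B\ne\emptyset$); (Union) $\mathsf{alive}(G)\wedge\mathsf{alive}(H)\to\mathsf{alive}(G\cup H)$; (Clo) $\mathsf{alive}(G)\to\mathsf{alive}(\{A\cup B\})$ for $A,B\in G$; rules modus ponens and $[G]$-necessitation. A pre-model $\mathcal{M}=(W,\sim,V)$ consists of a set $W$, a function assigning to each agent pattern $G$ a symmetric and transitive relation $\sim_G$ on $W$, and $V:W\to\mathcal{P}(\mathsf{Prop})$. Truth: $\mathcal{M},w\Vdash p$ iff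 $p\in V(w)$; Boolean clauses as usual; $\mathcal{M},w\Vdash[G]\varphi$ iff $\mathcal{M},v\Vdash\varphi$ for all $v$ with $w\sim_G v$. $\mathsf{alive}(G)_\mathcal{M}=\{w\mid w\sim_G w\}$. A $\kappa$-model is a pre-model such that for all agent patterns $G,H$: (K1) $\mathsf{alive}(G)_\mathcal{M}\cap\mathsf{alive}(H)_\mathcal{M}\subseteq\mathsf{alive}(G\cup H)_\mathcal{M}$; (K2) $\mathsf{alive}(G)_\mathcal{M}\subseteq\mathsf{alive}(\{A\cup B\})_\mathcal{M}$ for $A,B\in G$; (K3) $\sim_H\subseteq\sim_G$ if $G\subseteq H$; (K4) $\sim_G\subseteq\sim_{G\cup\{B\}}$ if some $A\in G$ has $\emptyset\ne B\subseteq A$; (NE) every $w\in W$ has an agent pattern $G$ with $w\sim_G w$. *)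

theory Defs
  imports Main "HOL-Library.Countable"
begin

definition patterns :: "'a set \<Rightarrow> 'a set set set" where
  "patterns Ag = Pow (Pow Ag - {{}})"

text \<open>The raw syntax allows arbitrary sets of sets of agents below the modality; the formulas
  over a given set of agents are singled out by \<open>is_formula\<close>.\<close>

datatype ('a, 'p) fm =
    Atom 'p
  | Neg "('a, 'p) fm"
  | Conj "('a, 'p) fm" "('a, 'p) fm"
  | Box "'a set set" "('a, 'p) fm"

primrec is_formula :: "'a set \<Rightarrow> ('a, 'p) fm \<Rightarrow> bool" where
  "is_formula Ag (Atom p) \<longleftrightarrow> True"
| "is_formula Ag (Neg \<phi>) \<longleftrightarrow> is_formula Ag \<phi>"
| "is_formula Ag (Conj \<phi> \<psi>) \<longleftrightarrow> is_formula Ag \<phi> \<and> is_formula Ag \<psi>"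
| "is_formula Ag (Box G \<phi>) \<longleftrightarrow> G \<in> patterns Ag \<and> is_formula Ag \<phi>"

definition Disj :: "('a, 'p) fm \<Rightarrow> ('a, 'p) fm \<Rightarrow> ('a, 'p) fm" where
  "Disj \<phi> \<psi> = Neg (Conj (Neg \<phi>) (Neg \<psi>))"

definition Imp :: "('a, 'p) fm \<Rightarrow> ('a, 'p) fm \<Rightarrow> ('a, 'p) fm" where
  "Imp \<phi> \<psi> = Neg (Conj \<phi> (Neg \<psi>))"

text \<open>The atom used to express falsity is an explicit parameter \<open>q\<close>, here and below.\<close>

definition Bot :: "'p \<Rightarrow> ('a, 'p) fm" where
  "Bot q = Conj (Atom q) (Neg (Atom q))"

definition alive :: "'p \<Rightarrow> 'a set set \<Rightarrow> ('a, 'p) fm" where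
  "alive q G = Neg (Box G (Bot q))"

fun BigDisj :: "'p \<Rightarrow> ('a, 'p) fm list \<Rightarrow> ('a, 'p) fm" where
  "BigDisj q [] = Bot q"
| "BigDisj q [\<phi>] = \<phi>"
| "BigDisj q (\<phi> # \<psi> # \<chi>s) = Disj \<phi> (BigDisj q (\<psi> # \<chi>s))"

text \<open>Propositional tautologies are the formulas true under every Boolean assignment to the
  formulas that are not Boolean combinations, i.e. atoms and boxed formulas.\<close>

primrec peval :: "(('a, 'p) fm \<Rightarrow> bool) \<Rightarrow> ('a, 'p) fm \<Rightarrow> bool" where
  "peval e (Atom p) \<longleftrightarrow> e (Atom p)"
| "peval e (Neg \<phi>) \<longleftrightarrow> \<not> peval e \<phi>"
| "peval e (Conj \<phi> \<psi>) \<longleftrightarrow> peval e \<phi> \<and> peval e \<psi>"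
| "peval e (Box G \<phi>) \<longleftrightarrow> e (Box G \<phi>)"

definition tautology :: "('a, 'p) fm \<Rightarrow> bool" where
  "tautology \<phi> \<longleftrightarrow> (\<forall>e. peval e \<phi>)"

text \<open>In \<open>NE\<close> the finite disjunction over all agent patterns may be formed along any
  repetition-free enumeration; these versions are propositionally equivalent.\<close>

inductive derivable :: "'a set \<Rightarrow> 'p \<Rightarrow> ('a, 'p) fm \<Rightarrow> bool" for Ag q where
  Taut: "is_formula Ag \<phi> \<Longrightarrow> tautology \<phi> \<Longrightarrow> derivable Ag q \<phi>"
| K: "G \<in> patterns Ag \<Longrightarrow> is_formula Ag \<phi> \<Longrightarrow> is_formula Ag \<psi> \<Longrightarrow>
    derivable Ag q (Imp (Box G (Imp \<phi> \<psi>)) (Imp (Box G \<phi>) (Box G \<psi>)))"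
| B: "G \<in> patterns Ag \<Longrightarrow> is_formula Ag \<phi> \<Longrightarrow>
    derivable Ag q (Imp \<phi> (Box G (Neg (Box G (Neg \<phi>)))))"
| Four: "G \<in> patterns Ag \<Longrightarrow> is_formula Ag \<phi> \<Longrightarrow>
    derivable Ag q (Imp (Box G \<phi>) (Box G (Box G \<phi>)))"
| T: "G \<in> patterns Ag \<Longrightarrow> is_formula Ag \<phi> \<Longrightarrow>
    derivable Ag q (Imp (alive q G) (Imp (Box G \<phi>) \<phi>))"
| NE: "set Gs = patterns Ag \<Longrightarrow> distinct Gs \<Longrightarrow>
    derivable Ag q (BigDisj q (map (alive q) Gs))"
| Mono: "G \<in> patterns Ag \<Longrightarrow> H \<in> patterns Ag \<Longrightarrow> G \<subseteq> H \<Longrightarrow> is_formula Ag \<phi> \<Longrightarrow>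
    derivable Ag q (Imp (Box G \<phi>) (Box H \<phi>))"
| Equiv: "G \<in> patterns Ag \<Longrightarrow> A \<in> G \<Longrightarrow> B \<subseteq> A \<Longrightarrow> B \<noteq> {} \<Longrightarrow> is_formula Ag \<phi> \<Longrightarrow>
    derivable Ag q (Imp (Box (G \<union> {B}) \<phi>) (Box G \<phi>))"
| Union: "G \<in> patterns Ag \<Longrightarrow> H \<in> patterns Ag \<Longrightarrow>
    derivable Ag q (Imp (Conj (alive q G) (alive q H)) (alive q (G \<union> H)))"
| Clo: "G \<in> patterns Ag \<Longrightarrow> A \<in> G \<Longrightarrow> B \<in> G \<Longrightarrow>
    derivable Ag q (Imp (alive q G) (alive q {A \<union> B}))"
| MP: "derivable Ag q (Imp \<phi> \<psi>) \<Longrightarrow> derivable Ag q \<phi> \<Longrightarrow> derivable Ag q \<psi>"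
| Nec: "G \<in> patterns Ag \<Longrightarrow> derivable Ag q \<phi> \<Longrightarrow> derivable Ag q (Box G \<phi>)"

record ('w, 'a, 'p) model =
  worlds :: "'w set"
  rel :: "'a set set \<Rightarrow> ('w \<times> 'w) set"
  val :: "'w \<Rightarrow> 'p set"

definition pre_model :: "'a set \<Rightarrow> ('w, 'a, 'p) model \<Rightarrow> bool" where
  "pre_model Ag M \<longleftrightarrow>
    (\<forall>G \<in> patterns Ag. rel M G \<subseteq> worlds M \<times> worlds M \<and> sym (rel M G) \<and> trans (rel M G))"

primrec sat :: "('w, 'a, 'p) model \<Rightarrow> 'w \<Rightarrow> ('a, 'p) fm \<Rightarrow> bool" where
  "sat M w (Atom p) \<longleftrightarrow> p \<in> val M w"
| "sat M w (Neg \<phi>) \<longleftrightarrow> \<not> sat M w \<phi>"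
| "sat M w (Conj \<phi> \<psi>) \<longleftrightarrow> sat M w \<phi> \<and> sat M w \<psi>"
| "sat M w (Box G \<phi>) \<longleftrightarrow> (\<forall>v \<in> worlds M. (w, v) \<in> rel M G \<longrightarrow> sat M v \<phi>)"

definition alive_worlds :: "('w, 'a, 'p) model \<Rightarrow> 'a set set \<Rightarrow> 'w set" where
  "alive_worlds M G = {w \<in> worlds M. (w, w) \<in> rel M G}"

definition kappa_model :: "'a set \<Rightarrow> ('w, 'a, 'p) model \<Rightarrow> bool" where
  "kappa_model Ag M \<longleftrightarrow> pre_model Ag M \<and>
    (\<forall>G \<in> patterns Ag. \<forall>H \<in> patterns Ag.
      alive_worlds M G \<inter> alive_worlds M H \<subseteq> alive_worlds M (G \<union> H)) \<and>
    (\<forall>G \<in> patterns Ag. \<forall>A \<in> G. \<forall>B \<in> G. alive_worlds M G \<subseteq> alive_worlds M {A \<union> B}) \<and>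
    (\<forall>G \<in> patterns Ag. \<forall>H \<in> patterns Ag. G \<subseteq> H \<longrightarrow> rel M H \<subseteq> rel M G) \<and>
    (\<forall>G \<in> patterns Ag. \<forall>B. B \<noteq> {} \<longrightarrow> (\<exists>A \<in> G. B \<subseteq> A) \<longrightarrow> rel M G \<subseteq> rel M (G \<union> {B})) \<and>
    (\<forall>w \<in> worlds M. \<exists>G \<in> patterns Ag. (w, w) \<in> rel M G)"

end

theory Submission
  imports Defs
begin

text \<open>
  Canonical model: the worlds are the maximal consistent sets of formulas, and \<open>w\<close> is
  \<open>G\<close>-related to \<open>v\<close> iff \<open>v\<close> contains every \<open>\<phi>\<close> with \<open>[G]\<phi> \<in> w\<close>. Each frame
  condition follows from the corresponding axiom; for those on liveness this is because a maximal consistent set is \<open>G\<close>-related to itself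
  iff it contains \<open>alive(G)\<close>. A non-derivable \<open>\<phi>\<close> fails at a maximal consistent set containing
  \<open>\<not>\<phi>\<close>.
\<close>

section \<open>Deduction from assumptions\<close>

text \<open>Necessitation is applicable to theorems only, hence the deduction theorem holds.\<close>

inductive deducible :: "'a set \<Rightarrow> 'p \<Rightarrow> ('a, 'p) fm set \<Rightarrow> ('a, 'p) fm \<Rightarrow> bool" for Ag q S where
  Asm: "\<phi> \<in> S \<Longrightarrow> deducible Ag q S \<phi>"
| Thm: "derivable Ag q \<phi> \<Longrightarrow> deducible Ag q S \<phi>"
| MP: "deducible Ag q S (Imp \<phi> \<psi>) \<Longrightarrow> deducible Ag q S \<phi> \<Longrightarrow> deducible Ag q S \<psi>"

section \<open>Well-formedness over a fixed set of agents\<close>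

lemma is_formula_Imp [simp]: "is_formula Ag (Imp \<phi> \<psi>) \<longleftrightarrow> is_formula Ag \<phi> \<and> is_formula Ag \<psi>"
  by (simp add: Imp_def)

lemma is_formula_Disj [simp]: "is_formula Ag (Disj \<phi> \<psi>) \<longleftrightarrow> is_formula Ag \<phi> \<and> is_formula Ag \<psi>"
  by (simp add: Disj_def)

lemma is_formula_Bot [simp]: "is_formula Ag (Bot q)"
  by (simp add: Bot_def)

lemma is_formula_alive [simp]: "is_formula Ag (alive q G) \<longleftrightarrow> G \<in> patterns Ag"
  by (simp add: alive_def)

lemma is_formula_BigDisj: "(\<And>\<phi>. \<phi> \<in> set \<phi>s \<Longrightarrow> is_formula Ag \<phi>) \<Longrightarrow> is_formula Ag (BigDisj q \<phi>s)"
  by (induction q \<phi>s rule: BigDisj.induct) auto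

lemma patterns_Un [simp]: "G \<union> H \<in> patterns Ag \<longleftrightarrow> G \<in> patterns Ag \<and> H \<in> patterns Ag"
  by (auto simp: patterns_def)

lemma patterns_subset_agents:
  "G \<in> patterns Ag \<Longrightarrow> A \<in> G \<Longrightarrow> B \<subseteq> A \<Longrightarrow> B \<noteq> {} \<Longrightarrow> {B} \<in> patterns Ag"
  by (auto simp: patterns_def)

lemma patterns_union_agents: "G \<in> patterns Ag \<Longrightarrow> A \<in> G \<Longrightarrow> B \<in> G \<Longrightarrow> {A \<union> B} \<in> patterns Ag"
  by (auto simp: patterns_def)

text \<open>The side conditions of the rules guarantee this; only in (Equiv) and (Clo) does a new
  pattern arise, and its agent set is nonempty and inherited from members of
  \<open>G\<close>.\<close>

lemma derivable_is_formula: "derivable Ag q \<phi> \<Longrightarrow> is_formula Ag \<phi>"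
proof (induction rule: derivable.induct)
  case (NE Gs)
  then show ?case by (intro is_formula_BigDisj) auto
next
  case (Equiv G A B \<phi>)
  \<comment> \<open>The two deleted rules would destroy the form \<open>G \<union> {B}\<close> on
    which \<open>patterns_Un\<close> acts.\<close>
  then show ?case using patterns_subset_agents[of G Ag A B]
    by (simp del: insert_iff Un_insert_right)
qed (simp_all add: patterns_union_agents)

lemma deducible_is_formula:
  "deducible Ag q S \<phi> \<Longrightarrow> S \<subseteq> Collect (is_formula Ag) \<Longrightarrow> is_formula Ag \<phi>"
  by (induction rule: deducible.induct) (auto dest: derivable_is_formula)

lemma deducible_taut: "is_formula Ag \<phi> \<Longrightarrow> tautology \<phi> \<Longrightarrow> deducible Ag q S \<phi>"
  by (intro deducible.Thm derivable.Taut)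

lemma deducible_empty: "deducible Ag q {} \<phi> \<Longrightarrow> derivable Ag q \<phi>"
  by (induction rule: deducible.induct) (simp, assumption, rule derivable.MP)

text \<open>Induction on the deduction. Well-formedness is assumed because each case appeals to a
  tautology, and tautologies are axioms only for formulas over \<open>Ag\<close>.\<close>

lemma deduction_theorem:
  assumes "deducible Ag q (insert \<phi> S) \<psi>" and \<phi>: "is_formula Ag \<phi>"
    and S: "S \<subseteq> Collect (is_formula Ag)"
  shows "deducible Ag q S (Imp \<phi> \<psi>)"
  using assms(1)
proof (induction rule: deducible.induct)
  case (Asm \<psi>)
  show ?case
  proof (cases "\<psi> = \<phi>")
    case True
    then show ?thesis using \<phi> by (auto intro!: deducible_taut simp: tautology_def Imp_def)
  next
    case False
    then have "\<psi> \<in> S" and "is_formula Ag \<psi>" using Asm S by auto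
    moreover have "deducible Ag q S (Imp \<psi> (Imp \<phi> \<psi>))"
      using \<phi> \<open>is_formula Ag \<psi>\<close> by (auto intro!: deducible_taut simp: tautology_def Imp_def)
    ultimately show ?thesis by (metis deducible.Asm deducible.MP)
  qed
next
  case (Thm \<psi>)
  moreover have "deducible Ag q S (Imp \<psi> (Imp \<phi> \<psi>))"
    using \<phi> derivable_is_formula[OF Thm]
    by (auto intro!: deducible_taut simp: tautology_def Imp_def)
  ultimately show ?case by (metis deducible.Thm deducible.MP)
next
  case (MP \<chi> \<psi>)
  have "is_formula Ag (Imp \<chi> \<psi>)" using deducible_is_formula[OF MP.hyps(1)] \<phi> S by simp
  then have "deducible Ag q S (Imp (Imp \<phi> (Imp \<chi> \<psi>)) (Imp (Imp \<phi> \<chi>) (Imp \<phi> \<psi>)))"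
    using \<phi> by (auto intro!: deducible_taut simp: tautology_def Imp_def)
  then show ?case using MP.IH by (metis deducible.MP)
qed

lemma deducible_mono: "deducible Ag q S \<phi> \<Longrightarrow> S \<subseteq> S' \<Longrightarrow> deducible Ag q S' \<phi>"
  by (induction rule: deducible.induct) (auto intro: deducible.Asm deducible.Thm elim: deducible.MP)

text \<open>Compactness in the form needed for Zorn's lemma: at modus ponens, the larger of two
  comparable members of the chain carries both premises. Nonemptiness supplies a member for
  theorems.\<close>

lemma deducible_Union_chain:
  assumes "deducible Ag q (\<Union>C) \<phi>" and "subset.chain A C" and "C \<noteq> {}"
  shows "\<exists>S\<in>C. deducible Ag q S \<phi>"
  using assms(1)
proof (induction rule: deducible.induct)
  case (Asm \<phi>)
  then show ?case by (blast intro: deducible.intros)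
next
  case (Thm \<phi>)
  then show ?case using assms(3) by (blast intro: deducible.intros)
next
  case (MP \<phi> \<psi>)
  then obtain S T where "S \<in> C" "T \<in> C" "deducible Ag q S (Imp \<phi> \<psi>)" "deducible Ag q T \<phi>"
    by blast
  moreover have "S \<subseteq> T \<or> T \<subseteq> S" using assms(2) \<open>S \<in> C\<close> \<open>T \<in> C\<close> by (auto simp: subset_chain_def)
  ultimately show ?case by (metis deducible.MP deducible_mono)
qed

lemma deducible_by_contradiction:
  assumes "deducible Ag q (insert (Neg \<phi>) S) (Bot q)" and "is_formula Ag \<phi>"
    and "S \<subseteq> Collect (is_formula Ag)"
  shows "deducible Ag q S \<phi>"
proof (rule deducible.MP)
  show "deducible Ag q S (Imp (Neg \<phi>) (Bot q))"
    using assms by (intro deduction_theorem) auto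
  show "deducible Ag q S (Imp (Imp (Neg \<phi>) (Bot q)) \<phi>)"
    using assms(2) by (auto intro!: deducible_taut simp: tautology_def Imp_def Bot_def)
qed

section \<open>Maximal consistent sets\<close>

text \<open>Maximality is stated as negation completeness, the form in which it is used, instead of
  maximality under inclusion.\<close>

definition max_consistent :: "'a set \<Rightarrow> 'p \<Rightarrow> ('a, 'p) fm set \<Rightarrow> bool" where
  "max_consistent Ag q w \<longleftrightarrow> w \<subseteq> Collect (is_formula Ag) \<and> \<not> deducible Ag q w (Bot q) \<and>
    (\<forall>\<phi>. is_formula Ag \<phi> \<longrightarrow> \<phi> \<in> w \<or> Neg \<phi> \<in> w)"

text \<open>Zorn's lemma on the consistent extensions of \<open>S\<close>. If a maximal one
  contained neither \<open>\<phi>\<close> nor \<open>Neg \<phi>\<close>, adding either would be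
  inconsistent, so it would deduce both \<open>Imp \<phi> (Bot q)\<close> and
  \<open>\<phi>\<close>.\<close>

lemma Lindenbaum:
  fixes S :: "('a, 'p) fm set"
  assumes "S \<subseteq> Collect (is_formula Ag)" and "\<not> deducible Ag q S (Bot q)"
  obtains w where "S \<subseteq> w" and "max_consistent Ag q w"
proof -
  define \<A> where
    "\<A> = {T. S \<subseteq> T \<and> T \<subseteq> Collect (is_formula Ag) \<and> \<not> deducible Ag q T (Bot q)}"
  have "\<exists>w\<in>\<A>. \<forall>T\<in>\<A>. w \<subseteq> T \<longrightarrow> T = w"
  proof (rule subset_Zorn_nonempty)
    show "\<A> \<noteq> {}" using assms by (auto simp: \<A>_def)
  next
    fix C assume C: "C \<noteq> {}" "subset.chain \<A> C"
    then have "C \<subseteq> \<A>" by (simp add: subset_chain_def)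
    then show "\<Union>C \<in> \<A>"
      using C deducible_Union_chain[of Ag q C "Bot q" \<A>] by (fastforce simp: \<A>_def)
  qed
  then obtain w where w: "w \<in> \<A>" and max: "\<And>T. T \<in> \<A> \<Longrightarrow> w \<subseteq> T \<Longrightarrow> T = w" by blast
  have "max_consistent Ag q w"
    unfolding max_consistent_def
  proof (intro conjI allI impI)
    fix \<phi> :: "('a, 'p) fm" assume \<phi>: "is_formula Ag \<phi>"
    have in_w: "\<psi> \<in> w" if "is_formula Ag \<psi>" "\<not> deducible Ag q (insert \<psi> w) (Bot q)" for \<psi>
      using max[of "insert \<psi> w"] w that by (auto simp: \<A>_def)
    show "\<phi> \<in> w \<or> Neg \<phi> \<in> w"
    proof (rule ccontr)
      assume "\<not> ?thesis"
      then have "deducible Ag q (insert \<phi> w) (Bot q)" "deducible Ag q (insert (Neg \<phi>) w) (Bot q)"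
        using \<phi> in_w[of \<phi>] in_w[of "Neg \<phi>"] by auto
      then have "deducible Ag q w (Imp \<phi> (Bot q))" "deducible Ag q w \<phi>"
        using \<phi> w by (auto simp: \<A>_def intro: deduction_theorem deducible_by_contradiction)
      then have "deducible Ag q w (Bot q)" by (rule deducible.MP)
      then show False using w by (simp add: \<A>_def)
    qed
  qed (use w in \<open>auto simp: \<A>_def\<close>)
  then show thesis using w that by (auto simp: \<A>_def)
qed

section \<open>Closure properties of a maximal consistent set\<close>

context
  fixes Ag :: "'a set" and q :: 'p and w :: "('a, 'p) fm set"
  assumes mc: "max_consistent Ag q w"
begin

lemma max_consistent_is_formula: "\<phi> \<in> w \<Longrightarrow> is_formula Ag \<phi>"
  using mc by (auto simp: max_consistent_def)

lemma max_consistent_Neg: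
  assumes "is_formula Ag \<phi>"
  shows "Neg \<phi> \<in> w \<longleftrightarrow> \<phi> \<notin> w"
proof -
  have "False" if "\<phi> \<in> w" "Neg \<phi> \<in> w"
  proof -
    have "deducible Ag q w (Imp \<phi> (Imp (Neg \<phi>) (Bot q)))"
      using assms by (auto intro!: deducible_taut simp: tautology_def Imp_def)
    then have "deducible Ag q w (Bot q)"
      using that by (metis deducible.Asm deducible.MP)
    then show False using mc by (simp add: max_consistent_def)
  qed
  then show ?thesis using mc assms by (auto simp: max_consistent_def)
qed

lemma max_consistent_deducible:
  assumes "deducible Ag q w \<phi>"
  shows "\<phi> \<in> w"
proof (rule ccontr)
  assume "\<phi> \<notin> w"
  moreover have \<phi>: "is_formula Ag \<phi>"
    using assms mc deducible_is_formula by (auto simp: max_consistent_def)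
  ultimately have "Neg \<phi> \<in> w" by (simp add: max_consistent_Neg)
  moreover have "deducible Ag q w (Imp \<phi> (Imp (Neg \<phi>) (Bot q)))"
    using \<phi> by (auto intro!: deducible_taut simp: tautology_def Imp_def)
  ultimately have "deducible Ag q w (Bot q)"
    using assms by (metis deducible.Asm deducible.MP)
  then show False using mc by (simp add: max_consistent_def)
qed

lemma max_consistent_derivable: "derivable Ag q \<phi> \<Longrightarrow> \<phi> \<in> w"
  by (simp add: max_consistent_deducible deducible.Thm)

lemma max_consistent_MP: "Imp \<phi> \<psi> \<in> w \<Longrightarrow> \<phi> \<in> w \<Longrightarrow> \<psi> \<in> w"
  by (metis max_consistent_deducible deducible.Asm deducible.MP)

lemma max_consistent_derivable_Imp: "derivable Ag q (Imp \<phi> \<psi>) \<Longrightarrow> \<phi> \<in> w \<Longrightarrow> \<psi> \<in> w"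
  by (rule max_consistent_MP[OF max_consistent_derivable])

lemma max_consistent_Conj:
  assumes "is_formula Ag \<phi>" "is_formula Ag \<psi>"
  shows "Conj \<phi> \<psi> \<in> w \<longleftrightarrow> \<phi> \<in> w \<and> \<psi> \<in> w"
proof -
  have "derivable Ag q (Imp (Conj \<phi> \<psi>) \<phi>)" "derivable Ag q (Imp (Conj \<phi> \<psi>) \<psi>)"
    "derivable Ag q (Imp \<phi> (Imp \<psi> (Conj \<phi> \<psi>)))"
    using assms by (auto intro!: derivable.Taut simp: tautology_def Imp_def)
  then show ?thesis by (metis max_consistent_derivable_Imp max_consistent_MP)
qed

lemma max_consistent_Bot: "Bot q \<notin> w"
  using mc by (auto simp: max_consistent_def intro: deducible.Asm)

lemma max_consistent_BigDisj:
  assumes "BigDisj q \<phi>s \<in> w" and "\<And>\<phi>. \<phi> \<in> set \<phi>s \<Longrightarrow> is_formula Ag \<phi>"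
  shows "\<exists>\<phi>\<in>set \<phi>s. \<phi> \<in> w"
  using assms
\<comment> \<open>This induction follows the three clauses of \<open>BigDisj\<close>, where a
  singleton list is not extended by \<open>Bot q\<close>.\<close>
proof (induction \<phi>s rule: induct_list012)
  case (3 \<phi> \<psi> \<chi>s)
  have "is_formula Ag (BigDisj q (\<psi> # \<chi>s))" using 3 by (intro is_formula_BigDisj) auto
  then have "\<phi> \<in> w \<or> BigDisj q (\<psi> # \<chi>s) \<in> w"
    using 3 by (auto simp: Disj_def max_consistent_Neg max_consistent_Conj)
  then show ?case using 3 by auto
qed (auto simp: max_consistent_Bot)

text \<open>Necessitation handles theorems and (K) handles modus ponens, so a whole deduction can be
  boxed step by step, without collecting its premises into a conjunction.\<close>

lemma max_consistent_deducible_Box: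
  assumes "G \<in> patterns Ag" and "deducible Ag q {\<psi>. Box G \<psi> \<in> w} \<phi>"
  shows "Box G \<phi> \<in> w"
  using assms(2)
proof (induction rule: deducible.induct)
  case (Thm \<phi>)
  then show ?case using assms(1) by (blast intro: max_consistent_derivable derivable.Nec)
next
  case (MP \<phi> \<psi>)
  then have "is_formula Ag \<phi>" "is_formula Ag \<psi>"
    using max_consistent_is_formula by fastforce+
  then have "Imp (Box G \<phi>) (Box G \<psi>) \<in> w"
    using MP.IH(1) by (rule max_consistent_derivable_Imp[OF derivable.K[OF assms(1)]])
  then show ?case using MP.IH(2) by (rule max_consistent_MP)
qed simp

end

section \<open>The canonical model\<close>

text \<open>Both components are required to be maximal consistent so that the relation stays within
  the worlds, as \<open>pre_model\<close> demands.\<close>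

definition canonical_rel ::
    "'a set \<Rightarrow> 'p \<Rightarrow> 'a set set \<Rightarrow> (('a, 'p) fm set \<times> ('a, 'p) fm set) set" where
  "canonical_rel Ag q G =
    {(w, v). max_consistent Ag q w \<and> max_consistent Ag q v \<and> {\<phi>. Box G \<phi> \<in> w} \<subseteq> v}"

definition canonical_model :: "'a set \<Rightarrow> 'p \<Rightarrow> (('a, 'p) fm set, 'a, 'p) model" where
  "canonical_model Ag q =
    \<lparr>worlds = Collect (max_consistent Ag q), rel = canonical_rel Ag q, val = \<lambda>w. {p. Atom p \<in> w}\<rparr>"

section \<open>Frame conditions of the canonical model\<close>

lemma sym_canonical_rel:
  assumes "G \<in> patterns Ag"
  shows "sym (canonical_rel Ag q G)"
proof (rule symI)
  fix w v assume "(w, v) \<in> canonical_rel Ag q G"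
  then have w: "max_consistent Ag q w" and v: "max_consistent Ag q v"
    and wv: "\<And>\<phi>. Box G \<phi> \<in> w \<Longrightarrow> \<phi> \<in> v" by (auto simp: canonical_rel_def)
  have "\<phi> \<in> w" if "Box G \<phi> \<in> v" for \<phi>
  proof (rule ccontr)
    assume "\<phi> \<notin> w"
    have \<phi>: "is_formula Ag \<phi>" using max_consistent_is_formula[OF v that] by simp
    then have "Neg \<phi> \<in> w" using \<open>\<phi> \<notin> w\<close> w by (simp add: max_consistent_Neg)
    then have "Box G (Neg (Box G (Neg (Neg \<phi>)))) \<in> w"
      using assms \<phi> by (intro max_consistent_derivable_Imp[OF w derivable.B]) auto
    then have "Neg (Box G (Neg (Neg \<phi>))) \<in> v" by (rule wv)
    \<comment> \<open>Axiom (B) was applied to \<open>Neg \<phi>\<close>, which leaves a double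
      negation under the inner box; necessitation and (K) carry \<open>Box G \<phi>\<close> over to
      that form.\<close>
    moreover have "Box G (Imp \<phi> (Neg (Neg \<phi>))) \<in> v"
      using assms \<phi>
      by (intro max_consistent_derivable[OF v] derivable.Nec derivable.Taut)
        (auto simp: tautology_def Imp_def)
    then have "Imp (Box G \<phi>) (Box G (Neg (Neg \<phi>))) \<in> v"
      using assms \<phi> by (intro max_consistent_derivable_Imp[OF v derivable.K]) auto
    then have "Box G (Neg (Neg \<phi>)) \<in> v" using that by (rule max_consistent_MP[OF v])
    ultimately show False using v assms \<phi> by (simp add: max_consistent_Neg)
  qed
  then show "(v, w) \<in> canonical_rel Ag q G" using w v by (auto simp: canonical_rel_def)
qed

lemma trans_canonical_rel:
  assumes "G \<in> patterns Ag"
  shows "trans (canonical_rel Ag q G)"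
proof (rule transI)
  fix w v u assume "(w, v) \<in> canonical_rel Ag q G" "(v, u) \<in> canonical_rel Ag q G"
  moreover have "Box G (Box G \<phi>) \<in> w" if "max_consistent Ag q w" "Box G \<phi> \<in> w" for \<phi>
    using that(2) assms max_consistent_is_formula[OF that]
    by (intro max_consistent_derivable_Imp[OF that(1) derivable.Four]) auto
  ultimately show "(w, u) \<in> canonical_rel Ag q G" by (auto simp: canonical_rel_def)
qed

text \<open>If \<open>Box G (Bot q)\<close> were in a reflexive \<open>w\<close>, so would be
  \<open>Bot q\<close>; conversely, (T) unboxes every formula once \<open>alive q G\<close> is in
  \<open>w\<close>.\<close>

lemma canonical_rel_refl_iff:
  assumes "G \<in> patterns Ag" and w: "max_consistent Ag q w"
  shows "(w, w) \<in> canonical_rel Ag q G \<longleftrightarrow> alive q G \<in> w"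
proof
  assume "(w, w) \<in> canonical_rel Ag q G"
  then have "Box G (Bot q) \<notin> w" using max_consistent_Bot[OF w] by (auto simp: canonical_rel_def)
  then show "alive q G \<in> w" using assms by (simp add: alive_def max_consistent_Neg)
next
  assume alive: "alive q G \<in> w"
  have "\<phi> \<in> w" if "Box G \<phi> \<in> w" for \<phi>
  proof -
    have "is_formula Ag \<phi>" using max_consistent_is_formula[OF w that] by simp
    then have "Imp (Box G \<phi>) \<phi> \<in> w"
      using alive by (rule max_consistent_derivable_Imp[OF w derivable.T[OF assms(1)]])
    then show ?thesis using that by (rule max_consistent_MP[OF w])
  qed
  then show "(w, w) \<in> canonical_rel Ag q G" using w by (auto simp: canonical_rel_def)
qed

text \<open>More boxed formulas in a world leave fewer successors, hence the reversed inclusion.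
  This is the common core of (K3) and (K4).\<close>

lemma canonical_rel_mono:
  assumes "G \<in> patterns Ag" "H \<in> patterns Ag"
    and "\<And>\<phi>. is_formula Ag \<phi> \<Longrightarrow> derivable Ag q (Imp (Box G \<phi>) (Box H \<phi>))"
  shows "canonical_rel Ag q H \<subseteq> canonical_rel Ag q G"
proof -
  have "Box H \<phi> \<in> w" if "max_consistent Ag q w" "Box G \<phi> \<in> w" for w \<phi>
    using that(2) max_consistent_is_formula[OF that]
    by (intro max_consistent_derivable_Imp[OF that(1) assms(3)]) auto
  then show ?thesis by (auto simp: canonical_rel_def)
qed

text \<open>Finiteness of \<open>Ag\<close> makes the set of patterns finite, so it can be listed to
  form an instance of (NE), one of whose disjuncts lies in \<open>w\<close>.\<close>

lemma max_consistent_alive_pattern: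
  assumes "finite Ag" and w: "max_consistent Ag q w"
  shows "\<exists>G\<in>patterns Ag. alive q G \<in> w"
proof -
  have "finite (patterns Ag)" using assms(1) by (simp add: patterns_def)
  then obtain Gs where Gs: "set Gs = patterns Ag" "distinct Gs"
    using finite_distinct_list by blast
  then have "BigDisj q (map (alive q) Gs) \<in> w"
    by (intro max_consistent_derivable[OF w] derivable.NE)
  then show ?thesis using max_consistent_BigDisj[OF w, of "map (alive q) Gs"] Gs by fastforce
qed

lemma kappa_model_canonical:
  assumes "finite Ag"
  shows "kappa_model Ag (canonical_model Ag q)"
proof -
  have alive_worlds: "alive_worlds (canonical_model Ag q) G =
      {w. max_consistent Ag q w \<and> alive q G \<in> w}" if "G \<in> patterns Ag" for G
    using that by (auto simp: alive_worlds_def canonical_model_def canonical_rel_refl_iff)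
  have "pre_model Ag (canonical_model Ag q)"
    using sym_canonical_rel trans_canonical_rel
    by (auto simp: pre_model_def canonical_model_def) (auto simp: canonical_rel_def)
  moreover have "alive_worlds (canonical_model Ag q) G \<inter> alive_worlds (canonical_model Ag q) H
      \<subseteq> alive_worlds (canonical_model Ag q) (G \<union> H)"
    if "G \<in> patterns Ag" "H \<in> patterns Ag" for G H
    using that
    by (auto simp: alive_worlds max_consistent_Conj
        intro: max_consistent_derivable_Imp[OF _ derivable.Union])
  moreover have "alive_worlds (canonical_model Ag q) G
      \<subseteq> alive_worlds (canonical_model Ag q) {A \<union> B}"
    if "G \<in> patterns Ag" "A \<in> G" "B \<in> G" for G A B
    using that patterns_union_agents[OF that]
    by (auto simp: alive_worlds intro: max_consistent_derivable_Imp[OF _ derivable.Clo])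
  moreover have "canonical_rel Ag q H \<subseteq> canonical_rel Ag q G"
    if "G \<in> patterns Ag" "H \<in> patterns Ag" "G \<subseteq> H" for G H
    using that by (intro canonical_rel_mono derivable.Mono)
  \<comment> \<open>Here \<open>canonical_rel_mono\<close> is used with the larger pattern in the
    role of its \<open>G\<close>, since (Equiv) removes \<open>B\<close> from the box.\<close>
  moreover have "canonical_rel Ag q G \<subseteq> canonical_rel Ag q (G \<union> {B})"
    if "G \<in> patterns Ag" "B \<noteq> {}" "A \<in> G" "B \<subseteq> A" for G A B
    using that patterns_subset_agents[of G Ag A B]
    by (intro canonical_rel_mono derivable.Equiv[of G Ag A]) (simp_all only: patterns_Un simp_thms)
  moreover have "\<exists>G\<in>patterns Ag. (w, w) \<in> canonical_rel Ag q G" if "max_consistent Ag q w" for w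
    using max_consistent_alive_pattern[OF assms that] that by (auto simp: canonical_rel_refl_iff)
  ultimately show ?thesis
    unfolding kappa_model_def
    by (intro conjI ballI allI impI; (elim bexE)?) (simp_all add: canonical_model_def)
qed

text \<open>If the formulas boxed in \<open>w\<close> were inconsistent with
  \<open>Neg \<phi>\<close>, they would deduce \<open>\<phi>\<close>, which would put
  \<open>Box G \<phi>\<close> into \<open>w\<close>. Otherwise a Lindenbaum extension is the
  required successor.\<close>

lemma canonical_rel_witness:
  assumes w: "max_consistent Ag q w" and "Box G \<phi> \<notin> w"
    and "G \<in> patterns Ag" "is_formula Ag \<phi>"
  shows "\<exists>v. (w, v) \<in> canonical_rel Ag q G \<and> \<phi> \<notin> v"
proof -
  let ?S = "{\<psi>. Box G \<psi> \<in> w}"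
  have S: "?S \<subseteq> Collect (is_formula Ag)" using max_consistent_is_formula[OF w] by fastforce
  have "\<not> deducible Ag q (insert (Neg \<phi>) ?S) (Bot q)"
    using deducible_by_contradiction[OF _ assms(4) S] max_consistent_deducible_Box[OF w assms(3)]
      assms(2) by blast
  then obtain v where v: "insert (Neg \<phi>) ?S \<subseteq> v" "max_consistent Ag q v"
    using Lindenbaum[of "insert (Neg \<phi>) ?S" Ag q] S assms(4) by auto
  then have "\<phi> \<notin> v" using assms(4) by (simp add: max_consistent_Neg[OF v(2), symmetric])
  then show ?thesis using v w by (auto simp: canonical_rel_def)
qed

text \<open>The world is generalized in the induction because the box case inspects successors.
  There, truth implies membership by \<open>canonical_rel_witness\<close>; the converse is the
  definition of \<open>canonical_rel\<close>.\<close>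

lemma truth_lemma:
  "is_formula Ag \<phi> \<Longrightarrow> max_consistent Ag q w \<Longrightarrow> sat (canonical_model Ag q) w \<phi> \<longleftrightarrow> \<phi> \<in> w"
proof (induction \<phi> arbitrary: w)
  case (Box G \<phi>)
  then have "sat (canonical_model Ag q) w (Box G \<phi>) \<longleftrightarrow>
      (\<forall>v. (w, v) \<in> canonical_rel Ag q G \<longrightarrow> \<phi> \<in> v)"
    by (auto simp: canonical_model_def canonical_rel_def)
  also have "\<dots> \<longleftrightarrow> Box G \<phi> \<in> w"
    using canonical_rel_witness[of Ag q w G \<phi>] Box.prems by (auto simp: canonical_rel_def)
  finally show ?case .
qed (auto simp: canonical_model_def max_consistent_Neg max_consistent_Conj)

theorem theorem5p17:
  fixes Ag :: "'a set" and q :: "'p::countable" and \<phi> :: "('a, 'p) fm"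
  assumes "finite Ag"
    and "is_formula Ag \<phi>"
    and "\<And>(M :: (('a, 'p) fm set, 'a, 'p) model) w.
           kappa_model Ag M \<Longrightarrow> w \<in> worlds M \<Longrightarrow> sat M w \<phi>"
  shows "derivable Ag q \<phi>"
proof (rule ccontr)
  assume "\<not> derivable Ag q \<phi>"
  then have "\<not> deducible Ag q {Neg \<phi>} (Bot q)"
    using assms(2) deducible_by_contradiction[of Ag q \<phi> "{}"] deducible_empty[of Ag q \<phi>] by blast
  then obtain w where w: "{Neg \<phi>} \<subseteq> w" "max_consistent Ag q w"
    using Lindenbaum[of "{Neg \<phi>}" Ag q] assms(2) by auto
  then have "\<phi> \<notin> w" using assms(2) by (simp add: max_consistent_Neg[OF w(2), symmetric])
  \<comment> \<open>Validity is assumed for models whose worlds are sets of formulas, which is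
    exactly the world type of the canonical model.\<close>
  moreover have "sat (canonical_model Ag q) w \<phi>"
    using assms(3)[OF kappa_model_canonical[OF assms(1)]] w(2) by (simp add: canonical_model_def)
  ultimately show False using truth_lemma[OF assms(2) w(2)] by simp
qed

end
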